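(* Let $V_1,\dots,V_\ell$ be a partition of $[p]$, let $f_j:\mathbb{R}^{V_j}\to\mathbb{R}$ be convex with $f_j(\mathbf 0)=0$ for $j\in[\ell]$, and let $Q\subseteq\{0,1\}^\ell$ be such that for every $j\in[\ell]$ there exists $z\in Q$ with $z_j=1$. Let $$W=\Big\{(z,\beta,t)\in Q\times\mathbb{R}^p\times\mathbb{R}\;:\;\sum_{j=1}^\ell f_j(\beta_{V_j})\le t,\ \ \beta_i(1-z_j)=0\ \ \forall j\in[\ell],\ i\in V_j\Big\}$$ and $$Y_s=\Big\{(z,\beta,t)\in\mathbb{R}^{\ell}\times\mathbb{R}^p\times\mathbb{R}\;:\;\sum_{j=1}^\ell z_jf_j\Big(\frac{\beta_{V_j}}{z_j}\Big)\le t,\ \ z\in\operatorname{conv}(Q)\Big\}.$$ Then $\operatorname{cl\,conv}(W)=Y_s$.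
   Context: Notation: $[p]=\{1,\dots,p\}$; $\beta_{V_j}$ is the subvector of $\beta$ indexed by $V_j$; $\operatorname{conv}$ denotes convex hull and $\operatorname{cl\,conv}$ the closure of the convex hull. Convention for perspectives: for $w>0$ the expression $w f_j(x/w)$ is the usual one, and for $w=0$ it is understood as $0f_j(x/0):=\lim_{w\to0^+}w f_j(x/w)\in(-\infty,+\infty]$ (an inequality with left-hand side $+\infty$ is never satisfied by real $t$). *)

theory Defs
  imports "HOL-Analysis.Analysis"
begin

text \<open>
  The space of vectors indexed by a subset \<open>V\<close> of the finite index type is rendered as the
  subspace of vectors vanishing outside \<open>V\<close>; a subvector is accordingly extended by zero.
\<close>

definition coord_space :: "'p::finite set \<Rightarrow> (real ^ 'p) set" where
  "coord_space V = {x. \<forall>i. i \<notin> V \<longrightarrow> x $ i = 0}"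

definition subvec :: "'p::finite set \<Rightarrow> real ^ 'p \<Rightarrow> real ^ 'p" where
  "subvec V \<beta> = (\<chi> i. if i \<in> V then \<beta> $ i else 0)"

text \<open>
  For \<open>w = 0\<close> the value is the limit in the extended reals as \<open>w\<close> decreases to 0; it exists
  whenever \<open>g\<close> is convex along the ray through \<open>x\<close> with \<open>g 0 = 0\<close>. Negative \<open>w\<close> is irrelevant below,
  since \<open>conv Q\<close> lies in the nonnegative orthant.
\<close>

definition persp :: "(real ^ 'p::finite \<Rightarrow> real) \<Rightarrow> real \<Rightarrow> real ^ 'p \<Rightarrow> ereal" where
  "persp g w x =
     (if w = 0 then Lim (at_right 0) (\<lambda>u. ereal (u * g (x /\<^sub>R u)))
      else ereal (w * g (x /\<^sub>R w)))"

definition W_set ::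
  "('l::finite \<Rightarrow> 'p::finite set) \<Rightarrow> ('l \<Rightarrow> real ^ 'p \<Rightarrow> real) \<Rightarrow> (real ^ 'l) set
     \<Rightarrow> ((real ^ 'l) \<times> (real ^ 'p) \<times> real) set" where
  "W_set V f Q =
     {(z, \<beta>, t). z \<in> Q \<and> (\<Sum>j\<in>UNIV. f j (subvec (V j) \<beta>)) \<le> t
        \<and> (\<forall>j. \<forall>i\<in>V j. \<beta> $ i * (1 - z $ j) = 0)}"

definition Ys_set ::
  "('l::finite \<Rightarrow> 'p::finite set) \<Rightarrow> ('l \<Rightarrow> real ^ 'p \<Rightarrow> real) \<Rightarrow> (real ^ 'l) set
     \<Rightarrow> ((real ^ 'l) \<times> (real ^ 'p) \<times> real) set" where
  "Ys_set V f Q =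
     {(z, \<beta>, t). (\<Sum>j\<in>UNIV. persp (f j) (z $ j) (subvec (V j) \<beta>)) \<le> ereal t
        \<and> z \<in> convex hull Q}"

end

theory Submission
  imports Defs
begin

text \<open>
  Write \<open>g\<^sub>j \<beta> = f\<^sub>j (\<beta>\<^bsub>V\<^sub>j\<^esub>)\<close>, a finite convex function on the whole space with \<open>g\<^sub>j 0 = 0\<close>.
  Along a fixed \<open>\<beta>\<close> the perspective \<open>w g\<^sub>j(\<beta>/w)\<close> is nonincreasing in \<open>w > 0\<close>
  (\<open>perspective_antimono\<close>). Hence for \<open>w \<ge> 0\<close>, including \<open>w = 0\<close>, its
  extended value is the increasing limit of the real numbers \<open>(w + u) g\<^sub>j(\<beta>/(w + u))\<close> as
  \<open>u\<close> decreases to 0. For each \<open>u > 0\<close> these are jointly convex and continuous in \<open>(w, \<beta>)\<close> on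
  \<open>w \<ge> 0\<close>. Using the same \<open>u\<close> for all \<open>j\<close> turns the inequality between extended reals that
  defines \<open>Y\<^sub>s\<close> into a family of real inequalities, one for each \<open>u > 0\<close> (\<open>sum_persp_le_iff\<close>).
  So \<open>Y\<^sub>s\<close> is an intersection of closed convex sets. It contains \<open>W\<close>, because on \<open>W\<close>
  every perspective term equals \<open>g\<^sub>j \<beta>\<close>. This gives \<open>cl conv W \<subseteq> Y\<^sub>s\<close>.

  For the converse, take first a point \<open>(z, \<beta>, t)\<close> of \<open>Y\<^sub>s\<close> all of whose \<open>z\<^sub>j\<close> are positive.
  Fix the block directions \<open>x\<^sub>j = \<beta>\<^bsub>V\<^sub>j\<^esub> / z\<^sub>j\<close>. The map
  \<open>\<Phi> q = (q, \<Sum>\<^sub>j q\<^sub>j x\<^sub>j, \<Sum>\<^sub>j q\<^sub>j f\<^sub>j(x\<^sub>j))\<close> is linear, sends the binary points of \<open>Q\<close> into \<open>W\<close>, and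
  sends \<open>z\<close> to \<open>(z, \<beta>, \<Sum>\<^sub>j z\<^sub>j f\<^sub>j(\<beta>\<^bsub>V\<^sub>j\<^esub>/z\<^sub>j))\<close>. As \<open>z\<close> lies in the convex hull of \<open>Q\<close>, its image
  lies in that of \<open>W\<close>, and the slack in \<open>t\<close> is absorbed by a translation
  (\<open>positive_Ys_set_in_convex_hull_W_set\<close>). An arbitrary point of \<open>Y\<^sub>s\<close> is reached as a limit
  along a segment towards \<open>(z', 0, 0)\<close>, where \<open>z'\<close> is a point of \<open>conv Q\<close> with all coordinates
  positive: \<open>Y\<^sub>s\<close> is convex, so the segment stays in it, and all its points other than
  the starting point have positive \<open>z\<close>-coordinates. Such a \<open>z'\<close> exists because every coordinate
  is switched on by some point of \<open>Q\<close>.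
\<close>

section \<open>The shifted perspective of a convex function\<close>

text \<open>
  Shifting the scale by \<open>u > 0\<close> keeps it away from 0 over all of \<open>w \<ge> 0\<close>, so that values are
  real and, for continuous \<open>g\<close>, depend continuously on \<open>(w, x)\<close> up to the boundary \<open>w = 0\<close>.
\<close>

definition shifted_persp :: "('a::real_vector \<Rightarrow> real) \<Rightarrow> real \<Rightarrow> real \<Rightarrow> 'a \<Rightarrow> real" where
  "shifted_persp g u w x = (w + u) * g (x /\<^sub>R (w + u))"

lemma shifted_persp_zero: "g 0 = 0 \<Longrightarrow> shifted_persp g u w 0 = 0"
  by (simp add: shifted_persp_def)

text \<open>
  The point \<open>x / w\<close> lies on the segment from \<open>0\<close> to \<open>x / v\<close>, at fraction \<open>v / w\<close>, and \<open>g\<close>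
  vanishes at \<open>0\<close>.
\<close>

lemma perspective_antimono:
  fixes g :: "'a::real_vector \<Rightarrow> real"
  assumes g: "convex_on UNIV g" and "g 0 = 0" and "0 < v" "v \<le> w"
  shows "w * g (x /\<^sub>R w) \<le> v * g (x /\<^sub>R v)"
proof -
  have "g ((1 - v / w) *\<^sub>R 0 + (v / w) *\<^sub>R (x /\<^sub>R v)) \<le> (1 - v / w) * g 0 + (v / w) * g (x /\<^sub>R v)"
    using assms by (intro convex_onD[OF g]) auto
  moreover have "(1 - v / w) *\<^sub>R 0 + (v / w) *\<^sub>R (x /\<^sub>R v) = x /\<^sub>R w"
    using assms by (simp add: divide_inverse)
  ultimately have "g (x /\<^sub>R w) \<le> (v / w) * g (x /\<^sub>R v)"
    using \<open>g 0 = 0\<close> by (simp only: mult_zero_right add_0_left)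
  then have "w * g (x /\<^sub>R w) \<le> w * ((v / w) * g (x /\<^sub>R v))"
    using assms by (intro mult_left_mono) auto
  then show ?thesis
    using assms by simp
qed

lemma convex_on_perspective:
  fixes g :: "'a::real_vector \<Rightarrow> real"
  assumes g: "convex_on UNIV g"
  shows "convex_on ({0<..} \<times> UNIV) (\<lambda>(w, x). w * g (x /\<^sub>R w))"
proof (rule convex_onI)
  show "convex ({0::real<..} \<times> (UNIV :: 'a set))"
    by (intro convex_Times) auto
next
  fix s :: real and p q :: "real \<times> 'a"
  assume s: "0 < s" "s < 1" and pq: "p \<in> {0<..} \<times> UNIV" "q \<in> {0<..} \<times> UNIV"
  obtain v x w y where p: "p = (v, x)" and q: "q = (w, y)"
    by (cases p, cases q)
  have pos: "v > 0" "w > 0"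
    using pq p q by auto
  define c where "c = (1 - s) * v + s * w"
  have c: "c > 0"
    unfolding c_def using s pos by (intro add_pos_pos mult_pos_pos) auto
  \<comment> \<open>The quotient of the combination is a convex combination of the two quotients, with
      weights proportional to \<open>(1 - s) * v\<close> and \<open>s * w\<close>.\<close>
  have weight: "1 - s * w / c = (1 - s) * v / c"
    using c by (simp add: field_simps) (simp add: c_def algebra_simps)
  have coeff: "(1 - s) * v / c * inverse v = inverse c * (1 - s)"
      "s * w / c * inverse w = inverse c * s"
    using pos c by (simp_all add: field_simps)
  have "((1 - s) *\<^sub>R x + s *\<^sub>R y) /\<^sub>R c
      = (1 - s * w / c) *\<^sub>R (x /\<^sub>R v) + (s * w / c) *\<^sub>R (y /\<^sub>R w)"
    unfolding weight by (simp only: scaleR_add_right scaleR_scaleR coeff)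
  then have "g (((1 - s) *\<^sub>R x + s *\<^sub>R y) /\<^sub>R c)
      \<le> (1 - s * w / c) * g (x /\<^sub>R v) + (s * w / c) * g (y /\<^sub>R w)"
    using convex_onD[OF g, of "s * w / c" "x /\<^sub>R v" "y /\<^sub>R w"] s pos c weight
    by (simp add: c_def)
  then have "c * g (((1 - s) *\<^sub>R x + s *\<^sub>R y) /\<^sub>R c)
      \<le> c * (((1 - s) * v / c) * g (x /\<^sub>R v) + (s * w / c) * g (y /\<^sub>R w))"
    unfolding weight using c by (intro mult_left_mono) auto
  also have "\<dots> = (1 - s) * (v * g (x /\<^sub>R v)) + s * (w * g (y /\<^sub>R w))"
    using c by (simp add: field_simps)
  finally show "(case (1 - s) *\<^sub>R p + s *\<^sub>R q of (w, x) \<Rightarrow> w * g (x /\<^sub>R w))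
      \<le> (1 - s) * (case p of (w, x) \<Rightarrow> w * g (x /\<^sub>R w)) + s * (case q of (w, x) \<Rightarrow> w * g (x /\<^sub>R w))"
    by (simp add: p q c_def)
qed

lemma shifted_persp_convex_combination:
  fixes g :: "'a::real_vector \<Rightarrow> real"
  assumes g: "convex_on UNIV g" and "u > 0" "v \<ge> 0" "w \<ge> 0" "0 \<le> s" "s \<le> 1"
  shows "shifted_persp g u ((1 - s) * v + s * w) ((1 - s) *\<^sub>R x + s *\<^sub>R y)
    \<le> (1 - s) * shifted_persp g u v x + s * shifted_persp g u w y"
proof -
  have "(1 - s) * v + s * w + u = (1 - s) * (v + u) + s * (w + u)"
    by (simp add: algebra_simps)
  then show ?thesis
    using convex_onD[OF convex_on_perspective[OF g], of s "(v + u, x)" "(w + u, y)"] assms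
    by (simp add: shifted_persp_def)
qed

text \<open>
  For \<open>w = 0\<close> the perspective is defined by \<^const>\<open>Lim\<close>, which says nothing until the limit is
  known to exist. It does exist, since a monotone family converges to its supremum in the extended
  reals. For \<open>w > 0\<close> the claim is continuity of the finite convex function \<open>g\<close>.
\<close>

lemma tendsto_shifted_persp:
  fixes g :: "real ^ 'p::finite \<Rightarrow> real"
  assumes g: "convex_on UNIV g" and "g 0 = 0" and "w \<ge> 0"
  shows "((\<lambda>u. ereal (shifted_persp g u w x)) \<longlongrightarrow> persp g w x) (at_right 0)"
proof (cases "w = 0")
  case True
  define h where "h u = ereal (u * g (x /\<^sub>R u))" for u
  have anti: "h u' \<le> h u" if "0 < u" "u \<le> u'" for u u'
    using perspective_antimono[OF g \<open>g 0 = 0\<close> that] by (simp add: h_def)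
  have lim: "(h \<longlongrightarrow> (SUP u\<in>{0<..}. h u)) (at_right 0)"
  proof (rule order_tendstoI)
    fix a assume "a < (SUP u\<in>{0<..}. h u)"
    then obtain u0 where u0: "u0 > 0" "a < h u0"
      by (auto simp: less_SUP_iff)
    have "a < h u" if "0 < u" "u < u0" for u
      using anti[of u u0] u0 that by (auto intro: less_le_trans)
    then show "\<forall>\<^sub>F u in at_right 0. a < h u"
      using u0 unfolding eventually_at_right_field by blast
  next
    fix a assume a: "(SUP u\<in>{0<..}. h u) < a"
    have "h u < a" if "0 < u" for u
      using SUP_upper[of u "{0<..}" h] that a by (auto intro: le_less_trans)
    then show "\<forall>\<^sub>F u in at_right 0. h u < a"
      unfolding eventually_at_right_field by (intro exI[of _ 1]) auto
  qed
  then have "(h \<longlongrightarrow> Lim (at_right 0) h) (at_right 0)"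
    using tendsto_Lim[OF _ lim] by simp
  then show ?thesis
    unfolding h_def by (simp add: True shifted_persp_def persp_def)
next
  case False
  then have w: "w > 0"
    using \<open>w \<ge> 0\<close> by simp
  have "continuous_on UNIV g"
    using g by (intro convex_on_continuous) auto
  moreover have "((\<lambda>u. x /\<^sub>R (w + u)) \<longlongrightarrow> x /\<^sub>R (w + 0)) (at_right 0)"
    using w by (intro tendsto_intros) auto
  ultimately have "((\<lambda>u. g (x /\<^sub>R (w + u))) \<longlongrightarrow> g (x /\<^sub>R (w + 0))) (at_right 0)"
    by (rule continuous_on_tendsto_compose) auto
  then have "((\<lambda>u. shifted_persp g u w x) \<longlongrightarrow> (w + 0) * g (x /\<^sub>R (w + 0))) (at_right 0)"
    unfolding shifted_persp_def by (intro tendsto_intros)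
  then show ?thesis
    using False by (simp add: persp_def)
qed

lemma shifted_persp_le_persp:
  fixes g :: "real ^ 'p::finite \<Rightarrow> real"
  assumes g: "convex_on UNIV g" and "g 0 = 0" and "w \<ge> 0" "u > 0"
  shows "ereal (shifted_persp g u w x) \<le> persp g w x"
proof (rule tendsto_lowerbound[OF tendsto_shifted_persp[OF assms(1-3)]])
  have "shifted_persp g u w x \<le> shifted_persp g v w x" if "0 < v" "v < u" for v
    unfolding shifted_persp_def
    using that assms by (intro perspective_antimono[OF g]) auto
  then show "\<forall>\<^sub>F v in at_right 0. ereal (shifted_persp g u w x) \<le> ereal (shifted_persp g v w x)"
    using \<open>u > 0\<close> unfolding eventually_at_right_field by auto
qed auto

text \<open>
  Addition of extended reals is discontinuous only where \<open>\<infinity>\<close> meets \<open>-\<infinity>\<close>, so excluding the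
  limit \<open>-\<infinity>\<close> suffices.
\<close>

lemma tendsto_sum_ereal_not_MInfty:
  fixes h :: "'i \<Rightarrow> 'a \<Rightarrow> ereal"
  assumes "finite A" "\<And>i. i \<in> A \<Longrightarrow> (h i \<longlongrightarrow> l i) F" "\<And>i. i \<in> A \<Longrightarrow> l i \<noteq> -\<infinity>"
  shows "((\<lambda>x. \<Sum>i\<in>A. h i x) \<longlongrightarrow> (\<Sum>i\<in>A. l i)) F"
  using assms
proof (induction A rule: finite_induct)
  case (insert i A)
  have "(\<Sum>i\<in>A. l i) \<noteq> -\<infinity>"
    using \<open>finite A\<close> insert.prems(2) by (induction A rule: finite_induct) auto
  with insert show ?case
    by (simp add: tendsto_add_ereal_nonneg)
qed simp

text \<open>
  This removes the extended reals from the problem: a single real inequality for each common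
  shift \<open>u\<close>, with closedness and convexity inherited by the intersection over \<open>u\<close>.
\<close>

lemma sum_persp_le_iff:
  fixes g :: "'l::finite \<Rightarrow> real ^ 'p::finite \<Rightarrow> real"
  assumes g: "\<And>j. convex_on UNIV (g j)" "\<And>j. g j 0 = 0" and w: "\<And>j. w j \<ge> 0"
  shows "(\<Sum>j\<in>UNIV. persp (g j) (w j) (x j)) \<le> ereal t
    \<longleftrightarrow> (\<forall>u>0. (\<Sum>j\<in>UNIV. shifted_persp (g j) u (w j) (x j)) \<le> t)"
proof (intro iffI allI impI)
  fix u :: real
  assume le: "(\<Sum>j\<in>UNIV. persp (g j) (w j) (x j)) \<le> ereal t" and u: "u > 0"
  have "(\<Sum>j\<in>UNIV. ereal (shifted_persp (g j) u (w j) (x j)))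
      \<le> (\<Sum>j\<in>UNIV. persp (g j) (w j) (x j))"
    by (intro sum_mono shifted_persp_le_persp g w u)
  with le have "ereal (\<Sum>j\<in>UNIV. shifted_persp (g j) u (w j) (x j)) \<le> ereal t"
    by (simp flip: sum_ereal)
  then show "(\<Sum>j\<in>UNIV. shifted_persp (g j) u (w j) (x j)) \<le> t"
    by simp
next
  assume le: "\<forall>u>0. (\<Sum>j\<in>UNIV. shifted_persp (g j) u (w j) (x j)) \<le> t"
  have fin: "persp (g j) (w j) (x j) \<noteq> -\<infinity>" for j
    using shifted_persp_le_persp[OF g w zero_less_one, of j j "x j"] by auto
  have "((\<lambda>u. \<Sum>j\<in>UNIV. ereal (shifted_persp (g j) u (w j) (x j)))
      \<longlongrightarrow> (\<Sum>j\<in>UNIV. persp (g j) (w j) (x j))) (at_right 0)"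
    by (intro tendsto_sum_ereal_not_MInfty tendsto_shifted_persp g w fin) auto
  then show "(\<Sum>j\<in>UNIV. persp (g j) (w j) (x j)) \<le> ereal t"
    by (rule tendsto_upperbound)
       (use le in \<open>auto simp: eventually_at_right_field intro: exI[of _ 1]\<close>)
qed

section \<open>Restriction to coordinate blocks\<close>

lemma linear_subvec: "linear (subvec V)"
  by (intro linearI) (simp_all add: subvec_def vec_eq_iff)

lemma subvec_scaleR: "subvec V (c *\<^sub>R \<beta>) = c *\<^sub>R subvec V \<beta>"
  by (simp add: linear_scale[OF linear_subvec])

lemma subvec_in_coord_space: "subvec V \<beta> \<in> coord_space V"
  by (simp add: subvec_def coord_space_def)

lemma subvec_eq_0_iff: "subvec V \<beta> = 0 \<longleftrightarrow> (\<forall>i\<in>V. \<beta> $ i = 0)"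
  by (auto simp: subvec_def vec_eq_iff)

text \<open>
  Composing with the linear projection onto a block moves convexity from the coordinate
  subspace to the whole space. There the domain is open, so that finite convex functions are
  continuous.
\<close>

lemma convex_on_subvec:
  assumes "convex_on (coord_space V) f"
  shows "convex_on UNIV (\<lambda>\<beta>. f (subvec V \<beta>))"
proof (rule convex_onI)
  fix s :: real and x y :: "real ^ 'a"
  assume "0 < s" "s < 1"
  then show "f (subvec V ((1 - s) *\<^sub>R x + s *\<^sub>R y))
      \<le> (1 - s) * f (subvec V x) + s * f (subvec V y)"
    using convex_onD[OF assms, of s "subvec V x" "subvec V y"]
    by (simp add: linear_add[OF linear_subvec] subvec_scaleR subvec_in_coord_space)
qed simp

lemma persp_subvec: "persp f w (subvec V \<beta>) = persp (\<lambda>\<beta>. f (subvec V \<beta>)) w \<beta>"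
  by (simp add: persp_def subvec_scaleR)

section \<open>Convex combinations of binary points\<close>

lemma convex_hull_binary_nonneg:
  fixes Q :: "(real ^ 'l) set"
  assumes "Q \<subseteq> {z. \<forall>j. z $ j \<in> {0, 1}}" and "z \<in> convex hull Q"
  shows "z $ j \<ge> 0"
proof -
  have "convex {z :: real ^ 'l. z $ j \<ge> 0}"
    by (auto simp: convex_def)
  moreover have "Q \<subseteq> {z. z $ j \<ge> 0}"
  proof
    fix q assume "q \<in> Q"
    then have "q $ j \<in> {0, 1}"
      using assms(1) by blast
    then show "q \<in> {z. z $ j \<ge> 0}"
      by auto
  qed
  ultimately have "convex hull Q \<subseteq> {z. z $ j \<ge> 0}"
    by (intro hull_minimal)
  with assms(2) show ?thesis
    by auto
qed

lemma finite_binary_vectors: "finite {z :: real ^ 'l::finite. \<forall>j. z $ j \<in> {0, 1}}"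
proof (rule finite_subset)
  show "{z :: real ^ 'l. \<forall>j. z $ j \<in> {0, 1}} \<subseteq> range (\<lambda>S. \<chi> j. if j \<in> S then 1 else 0)"
  proof
    fix z :: "real ^ 'l" assume "z \<in> {z. \<forall>j. z $ j \<in> {0, 1}}"
    then have "z = (\<chi> j. if j \<in> {j. z $ j = 1} then 1 else 0)"
      by (auto simp: vec_eq_iff)
    then show "z \<in> range (\<lambda>S. \<chi> j. if j \<in> S then 1 else 0)"
      by (rule range_eqI)
  qed
qed simp

text \<open>Average, over all coordinates, one point of \<open>Q\<close> that switches the coordinate on.\<close>

lemma exists_positive_in_convex_hull:
  fixes Q :: "(real ^ 'l::finite) set"
  assumes Q: "Q \<subseteq> {z. \<forall>j. z $ j \<in> {0, 1}}" and "\<And>j. \<exists>z\<in>Q. z $ j = 1"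
  obtains z where "z \<in> convex hull Q" "\<And>j. z $ j > 0"
proof -
  obtain q where q: "\<And>j. q j \<in> Q" "\<And>j. q j $ j = 1"
    using assms(2) by metis
  define z where "z = (\<Sum>j\<in>UNIV. (1 / real CARD('l)) *\<^sub>R q j)"
  have "z \<in> convex hull Q"
    unfolding z_def using q by (intro convex_sum) (auto simp: hull_inc)
  moreover have "z $ k > 0" for k
  proof -
    have "0 < (1 / real CARD('l)) * q k $ k"
      using q by simp
    also have "\<dots> \<le> (\<Sum>j\<in>UNIV. (1 / real CARD('l)) * q j $ k)"
      using convex_hull_binary_nonneg[OF Q hull_inc[OF q(1)]]
      by (intro member_le_sum[where f = "\<lambda>j. (1 / real CARD('l)) * q j $ k"]) auto
    finally show ?thesis
      by (simp add: z_def)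
  qed
  ultimately show ?thesis
    using that by blast
qed

section \<open>The two inclusions\<close>

locale indicator_blocks =
  fixes V :: "'l::finite \<Rightarrow> 'p::finite set"
    and f :: "'l \<Rightarrow> real ^ 'p \<Rightarrow> real"
    and Q :: "(real ^ 'l) set"
  assumes inj_V: "inj V" and partition_V: "partition_on UNIV (range V)"
    and convex_f: "\<And>j. convex_on (coord_space (V j)) (f j)"
    and f_0: "\<And>j. f j 0 = 0"
    and binary_Q: "Q \<subseteq> {z. \<forall>j. z $ j \<in> {0, 1}}"
begin

definition block_fun :: "'l \<Rightarrow> real ^ 'p \<Rightarrow> real" where
  "block_fun j \<beta> = f j (subvec (V j) \<beta>)"

lemma convex_block_fun: "convex_on UNIV (block_fun j)"
  unfolding block_fun_def by (rule convex_on_subvec[OF convex_f])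

lemma block_fun_0: "block_fun j 0 = 0"
  by (simp add: block_fun_def linear_0[OF linear_subvec] f_0)

lemma blocks_disjoint: "i \<in> V j \<Longrightarrow> i \<in> V k \<Longrightarrow> j = k"
proof -
  assume "i \<in> V j" "i \<in> V k"
  moreover have "disjoint (range V)"
    using partition_V by (simp add: partition_on_def)
  ultimately have "V j = V k"
    unfolding disjoint_def by blast
  with inj_V show "j = k"
    by (rule injD)
qed

lemma blocks_cover: "\<exists>j. i \<in> V j"
  using partition_V by (auto simp: partition_on_def)

lemma Ys_set_iff_shifted:
  "(z, \<beta>, t) \<in> Ys_set V f Q \<longleftrightarrow>
    z \<in> convex hull Q \<and> (\<forall>u>0. (\<Sum>j\<in>UNIV. shifted_persp (block_fun j) u (z $ j) \<beta>) \<le> t)"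
proof (cases "z \<in> convex hull Q")
  case True
  then have "z $ j \<ge> 0" for j
    by (rule convex_hull_binary_nonneg[OF binary_Q])
  then show ?thesis
    using True sum_persp_le_iff[of block_fun "\<lambda>j. z $ j" "\<lambda>_. \<beta>" t] convex_block_fun block_fun_0
    by (simp add: Ys_set_def persp_subvec block_fun_def[abs_def])
qed (simp add: Ys_set_def)

text \<open>
  On an active block the shifted perspective is at most its value at scale 1, by monotonicity;
  on an inactive block the indicator constraint forces the subvector, and with it both sides, to
  vanish.
\<close>

lemma W_set_subset_Ys_set: "W_set V f Q \<subseteq> Ys_set V f Q"
proof (clarify)
  fix z \<beta> t assume W: "(z, \<beta>, t) \<in> W_set V f Q"
  then have z: "z \<in> Q" and le: "(\<Sum>j\<in>UNIV. block_fun j \<beta>) \<le> t"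
    and ind: "\<And>j i. i \<in> V j \<Longrightarrow> \<beta> $ i * (1 - z $ j) = 0"
    by (auto simp: W_set_def block_fun_def)
  have "shifted_persp (block_fun j) u (z $ j) \<beta> \<le> block_fun j \<beta>" if "u > 0" for u j
  proof (cases "z $ j = 1")
    case True
    then show ?thesis
      using perspective_antimono[OF convex_block_fun block_fun_0, where v = 1 and w = "1 + u" and x = \<beta>] \<open>u > 0\<close>
      by (simp add: shifted_persp_def)
  next
    case False
    then have "subvec (V j) \<beta> = 0"
      using ind by (auto simp: subvec_eq_0_iff)
    then show ?thesis
      by (simp add: shifted_persp_def block_fun_def subvec_scaleR f_0)
  qed
  then have "(\<Sum>j\<in>UNIV. shifted_persp (block_fun j) u (z $ j) \<beta>) \<le> t" if "u > 0" for u
    using le that by (meson sum_mono order_trans)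
  then show "(z, \<beta>, t) \<in> Ys_set V f Q"
    using z by (simp add: Ys_set_iff_shifted hull_inc)
qed

lemma convex_Ys_set: "convex (Ys_set V f Q)"
  unfolding convex_alt
proof (intro ballI allI impI)
  fix p q and s :: real
  assume p: "p \<in> Ys_set V f Q" and q: "q \<in> Ys_set V f Q" and s: "0 \<le> s \<and> s \<le> 1"
  obtain z \<beta> t z' \<beta>' t' where pq: "p = (z, \<beta>, t)" "q = (z', \<beta>', t')"
    by (metis prod_cases3)
  note p' = p[unfolded pq Ys_set_iff_shifted] and q' = q[unfolded pq Ys_set_iff_shifted]
  have "(\<Sum>j\<in>UNIV. shifted_persp (block_fun j) u (((1 - s) *\<^sub>R z + s *\<^sub>R z') $ j) ((1 - s) *\<^sub>R \<beta> + s *\<^sub>R \<beta>'))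
      \<le> (1 - s) * t + s * t'" if "u > 0" for u
  proof -
    have "(\<Sum>j\<in>UNIV. shifted_persp (block_fun j) u (((1 - s) *\<^sub>R z + s *\<^sub>R z') $ j) ((1 - s) *\<^sub>R \<beta> + s *\<^sub>R \<beta>'))
        \<le> (\<Sum>j\<in>UNIV. (1 - s) * shifted_persp (block_fun j) u (z $ j) \<beta> + s * shifted_persp (block_fun j) u (z' $ j) \<beta>')"
      using that s p' q' convex_hull_binary_nonneg[OF binary_Q]
      by (intro sum_mono) (simp add: shifted_persp_convex_combination convex_block_fun)
    also have "\<dots> = (1 - s) * (\<Sum>j\<in>UNIV. shifted_persp (block_fun j) u (z $ j) \<beta>)
        + s * (\<Sum>j\<in>UNIV. shifted_persp (block_fun j) u (z' $ j) \<beta>')"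
      by (simp add: sum.distrib sum_distrib_left)
    also have "\<dots> \<le> (1 - s) * t + s * t'"
      using p' q' s that by (intro add_mono mult_left_mono) auto
    finally show ?thesis .
  qed
  moreover have "(1 - s) *\<^sub>R z + s *\<^sub>R z' \<in> convex hull Q"
    using p' q' s by (intro convexD) auto
  ultimately show "(1 - s) *\<^sub>R p + s *\<^sub>R q \<in> Ys_set V f Q"
    by (simp add: pq Ys_set_iff_shifted)
qed

lemma closed_Ys_set: "closed (Ys_set V f Q)"
proof -
  define C :: "((real ^ 'l) \<times> (real ^ 'p) \<times> real) set" where "C = (convex hull Q) \<times> UNIV"
  have "finite Q"
    using binary_Q finite_binary_vectors by (rule finite_subset)
  then have "closed C"
    unfolding C_def
    by (intro closed_Times closed_UNIV compact_imp_closed compact_convex_hull finite_imp_compact)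
  have cont_block_fun: "continuous_on UNIV (block_fun j)" for j
    using convex_block_fun by (intro convex_on_continuous) auto
  have closed_u: "closed {p \<in> C. (\<Sum>j\<in>UNIV. shifted_persp (block_fun j) u (fst p $ j) (fst (snd p))) \<le> snd (snd p)}"
    if "u > 0" for u
  proof (rule continuous_on_closed_Collect_le[OF _ _ \<open>closed C\<close>])
    have "fst p $ j + u \<noteq> 0" if "p \<in> C" for p j
      using convex_hull_binary_nonneg[OF binary_Q, of "fst p" j] that \<open>u > 0\<close> by (auto simp: C_def)
    then show "continuous_on C (\<lambda>p. \<Sum>j\<in>UNIV. shifted_persp (block_fun j) u (fst p $ j) (fst (snd p)))"
      unfolding shifted_persp_def
      by (intro continuous_intros continuous_on_compose2[OF cont_block_fun]) auto
  qed (intro continuous_intros)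
  have "Ys_set V f Q = (\<Inter>u\<in>{0<..}.
      {p \<in> C. (\<Sum>j\<in>UNIV. shifted_persp (block_fun j) u (fst p $ j) (fst (snd p))) \<le> snd (snd p)})"
    using gt_ex[of "0::real"]
    by (auto simp: set_eq_iff Ys_set_iff_shifted C_def)
  also have "closed \<dots>"
    using closed_u by (intro closed_INT) auto
  finally show ?thesis .
qed

text \<open>
  A convex combination of points of \<open>Q\<close> representing \<open>z\<close> is lifted to \<open>W\<close> by giving each
  active block the same direction \<open>\<beta> / z\<^sub>j\<close> in every point of the combination. Since the
  directions do not depend on the points, the lifting is linear.
\<close>

lemma positive_Ys_set_in_convex_hull_W_set:
  assumes Y: "(z, \<beta>, t) \<in> Ys_set V f Q" and pos: "\<And>j. z $ j > 0"
  shows "(z, \<beta>, t) \<in> convex hull (W_set V f Q)"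
proof -
  define x where "x j = subvec (V j) (\<beta> /\<^sub>R z $ j)" for j
  define \<Phi> :: "real ^ 'l \<Rightarrow> (real ^ 'l) \<times> (real ^ 'p) \<times> real" where
    "\<Phi> q = (q, (\<Sum>j\<in>UNIV. q $ j *\<^sub>R x j), (\<Sum>j\<in>UNIV. q $ j * f j (x j)))" for q
  define \<sigma> where "\<sigma> = t - (\<Sum>j\<in>UNIV. z $ j * f j (x j))"
  have z: "z \<in> convex hull Q"
    using Y by (simp add: Ys_set_def)
  have "(\<Sum>j\<in>UNIV. ereal (z $ j * f j (x j))) \<le> ereal t"
    using Y pos[THEN less_imp_neq] by (simp add: Ys_set_def persp_def x_def subvec_scaleR)
  then have \<sigma>: "\<sigma> \<ge> 0"
    by (simp add: \<sigma>_def)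
  have linear: "linear \<Phi>"
    by (rule linearI) (simp_all add: \<Phi>_def algebra_simps sum.distrib scaleR_sum_right sum_distrib_left)
  have coord: "(\<Sum>k\<in>UNIV. q $ k *\<^sub>R x k) $ i = q $ j * x j $ i" if "i \<in> V j" for q :: "real ^ 'l" and i j
  proof -
    have "x k $ i = 0" if "k \<noteq> j" for k
      using blocks_disjoint \<open>i \<in> V j\<close> that by (auto simp: x_def subvec_def)
    then have "(\<Sum>k\<in>UNIV. q $ k * x k $ i) = (\<Sum>k\<in>{j}. q $ k * x k $ i)"
      by (intro sum.mono_neutral_right) auto
    then show ?thesis
      by simp
  qed
  have block: "subvec (V j) (\<Sum>k\<in>UNIV. q $ k *\<^sub>R x k) = q $ j *\<^sub>R x j" for q j
    using coord by (auto simp: vec_eq_iff subvec_def x_def)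
  \<comment> \<open>For binary scales, \<open>f j\<close> commutes with scaling along \<open>x j\<close>, because \<open>f j 0 = 0\<close>.\<close>
  have "(0, 0, \<sigma>) + \<Phi> q \<in> W_set V f Q" if "q \<in> Q" for q
  proof -
    have q: "q $ j = 0 \<or> q $ j = 1" for j
      using that binary_Q by auto
    have "f j (q $ j *\<^sub>R x j) = q $ j * f j (x j)" for j
      using q[of j] f_0 by auto
    moreover have "(\<Sum>k\<in>UNIV. q $ k *\<^sub>R x k) $ i * (1 - q $ j) = 0" if "i \<in> V j" for i j
      using q[of j] coord[OF that] by auto
    ultimately show ?thesis
      using that \<sigma> by (auto simp: W_set_def \<Phi>_def block)
  qed
  then have "convex hull ((+) (0, 0, \<sigma>) ` \<Phi> ` Q) \<subseteq> convex hull (W_set V f Q)"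
    by (intro hull_mono) auto
  moreover have "(0, 0, \<sigma>) + \<Phi> z \<in> convex hull ((+) (0, 0, \<sigma>) ` \<Phi> ` Q)"
    using z by (simp add: convex_hull_translation flip: convex_hull_linear_image[OF linear])
  moreover have "(0, 0, \<sigma>) + \<Phi> z = (z, \<beta>, t)"
  proof -
    have "(\<Sum>k\<in>UNIV. z $ k *\<^sub>R x k) $ i = \<beta> $ i" for i
    proof -
      obtain j where "i \<in> V j"
        using blocks_cover by blast
      then show ?thesis
        using coord[of i j z] pos[of j] by (simp add: x_def subvec_def)
    qed
    then show ?thesis
      by (simp add: \<Phi>_def \<sigma>_def vec_eq_iff)
  qed
  ultimately show ?thesis
    by auto
qed

end

theorem theorem3:
  fixes V :: "'l::finite \<Rightarrow> 'p::finite set"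
    and f :: "'l \<Rightarrow> real ^ 'p \<Rightarrow> real"
    and Q :: "(real ^ 'l) set"
  assumes "inj V" and "partition_on UNIV (range V)"
    and "\<And>j. convex_on (coord_space (V j)) (f j)"
    and "\<And>j. f j 0 = 0"
    and "Q \<subseteq> {z. \<forall>j. z $ j \<in> {0, 1}}"
    and "\<And>j. \<exists>z\<in>Q. z $ j = 1"
  shows "closure (convex hull (W_set V f Q)) = Ys_set V f Q"
proof
  interpret indicator_blocks V f Q
    using assms(1-5) by unfold_locales
  show "closure (convex hull (W_set V f Q)) \<subseteq> Ys_set V f Q"
    by (intro closure_minimal hull_minimal W_set_subset_Ys_set convex_Ys_set closed_Ys_set)
  show "Ys_set V f Q \<subseteq> closure (convex hull (W_set V f Q))"
  proof (clarify)
    fix z \<beta> t assume Y: "(z, \<beta>, t) \<in> Ys_set V f Q"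
    obtain z' where z': "z' \<in> convex hull Q" "\<And>j. z' $ j > 0"
      using exists_positive_in_convex_hull[OF assms(5,6)] by blast
    have Y': "(z', 0, 0) \<in> Ys_set V f Q"
      using z' by (simp add: Ys_set_iff_shifted shifted_persp_zero block_fun_0)
    define r where "r s = (1 - s) *\<^sub>R (z, \<beta>, t) + s *\<^sub>R (z', 0, 0)" for s
    have "r s \<in> convex hull (W_set V f Q)" if "0 < s" "s < 1" for s
    proof -
      have "r s \<in> Ys_set V f Q"
        unfolding r_def using that by (intro convexD[OF convex_Ys_set Y Y']) auto
      moreover have "((1 - s) *\<^sub>R z + s *\<^sub>R z') $ j > 0" for j
        using z'(2)[of j] convex_hull_binary_nonneg[OF binary_Q, of z j] Y that
        by (simp add: Ys_set_def add_nonneg_pos)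
      ultimately show ?thesis
        using positive_Ys_set_in_convex_hull_W_set by (simp add: r_def)
    qed
    then have "\<forall>\<^sub>F s in at_right 0. r s \<in> closure (convex hull (W_set V f Q))"
      unfolding eventually_at_right_field
      by (intro exI[of _ 1]) (auto intro: closure_subset[THEN subsetD])
    moreover have "(r \<longlongrightarrow> (1 - 0) *\<^sub>R (z, \<beta>, t) + 0 *\<^sub>R (z', 0, 0)) (at_right 0)"
      unfolding r_def by (intro tendsto_intros)
    ultimately have "(1 - 0) *\<^sub>R (z, \<beta>, t) + 0 *\<^sub>R (z', 0, 0) \<in> closure (convex hull (W_set V f Q))"
      by (intro Lim_in_closed_set[OF closed_closure]) auto
    then show "(z, \<beta>, t) \<in> closure (convex hull (W_set V f Q))"
      by simp
  qed
qed

end
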